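(* For any positive integer $n$, the number of inequivalent integer quadrilaterals with perimeter $n$ is the nearest integer to $\frac{n^3-3n^2+20n}{96}$ if $n$ is even, and the nearest integer to $\frac{n^3-7n}{96}$ if $n$ is odd.
   Context: An integer quadrilateral is a $4$-sided polygon whose side lengths are all positive integers; its perimeter is the sum of the side lengths. Reading the side lengths starting from any side, clockwise or anticlockwise, gives a $4$-tuple; two quadrilaterals are equivalent if the $4$-tuple of one can be obtained from that of the other by cyclically re-ordering and/or reversing the entries. (Side-length tuples of integer quadrilaterals of perimeter $n$ are exactly $4$-tuples of positive integers summing to $n$ with every entry less than $n/2$.) *)

theory Defs
  imports "HOL-Analysis.Analysis"
begin

text \<open>
  A quadrilateral is given by its vertices, in cyclic order, in the plane \<open>\<complex>\<close>. Non-collinearity of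
  consecutive vertices makes adjacent sides meet in their common vertex only and rules out straight
  angles, so that the polygon really has four sides; opposite sides must not meet.
\<close>

type_synonym quad = "complex \<times> complex \<times> complex \<times> complex"

fun quadrilateral :: "quad \<Rightarrow> bool" where
  "quadrilateral (A, B, C, D) \<longleftrightarrow>
     \<not> collinear {A, B, C} \<and> \<not> collinear {B, C, D} \<and>
     \<not> collinear {C, D, A} \<and> \<not> collinear {D, A, B} \<and>
     closed_segment A B \<inter> closed_segment C D = {} \<and>
     closed_segment B C \<inter> closed_segment D A = {}"

fun side_lengths :: "quad \<Rightarrow> real list" where
  "side_lengths (A, B, C, D) = [dist A B, dist B C, dist C D, dist D A]"

definition perimeter :: "quad \<Rightarrow> real" where
  "perimeter Q = sum_list (side_lengths Q)"

definition integer_quadrilateral :: "quad \<Rightarrow> bool" where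
  "integer_quadrilateral Q \<longleftrightarrow>
     quadrilateral Q \<and> (\<forall>s \<in> set (side_lengths Q). s \<in> \<int> \<and> 0 < s)"

definition equivalent_quads :: "quad \<Rightarrow> quad \<Rightarrow> bool" where
  "equivalent_quads P Q \<longleftrightarrow>
     (\<exists>k. side_lengths Q = rotate k (side_lengths P) \<or>
          side_lengths Q = rotate k (rev (side_lengths P)))"

definition integer_quads :: "nat \<Rightarrow> quad set" where
  "integer_quads n = {Q. integer_quadrilateral Q \<and> perimeter Q = real n}"

definition quad_equiv :: "nat \<Rightarrow> (quad \<times> quad) set" where
  "quad_equiv n = {(P, Q). P \<in> integer_quads n \<and> Q \<in> integer_quads n \<and> equivalent_quads P Q}"

definition num_integer_quads :: "nat \<Rightarrow> nat" where
  "num_integer_quads n = card (integer_quads n // quad_equiv n)"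

end

theory Submission
  imports Defs
begin

text \<open>
  Gluing two triangles along a diagonal shows that the side lengths that occur are exactly the
  tuples \<open>(a, b, c, d)\<close> with every entry less than half of the sum. Up to equivalence \<open>a \<le> c\<close>,
  \<open>b \<le> d\<close> and \<open>s = a + c \<le> n - s\<close>. For given \<open>s < n/2\<close> there are \<open>\<lfloor>s/2\<rfloor>\<close> choices of \<open>{a, c}\<close>, and
  \<open>\<lfloor>s/2\<rfloor>\<close> (\<open>n\<close> even) or \<open>\<lfloor>(s+1)/2\<rfloor>\<close> (\<open>n\<close> odd) choices of \<open>{b, d}\<close>; for \<open>s = n/2\<close> one counts
  unordered pairs of such choices. Summation gives a cubic in \<open>\<lfloor>n/4\<rfloor>\<close> for each residue of \<open>n\<close>
  modulo 4, which differs from the given one by \<open>0\<close>, \<open>1/16\<close>, \<open>-3/8\<close> or \<open>-1/16\<close>.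
\<close>

section \<open>Realising side lengths\<close>

lemma collinear_complex_cross:
  fixes x y z :: complex
  assumes "collinear {x, y, z}"
  shows "(Re x - Re y) * (Im z - Im y) = (Im x - Im y) * (Re z - Re y)"
proof -
  have "collinear {0, x - y, z - y}"
    using assms collinear_3[of x y z] by simp
  then consider "x = y" | "z = y" | t where "z - y = t *\<^sub>R (x - y)"
    unfolding collinear_lemma by auto
  then show ?thesis
  proof cases
    case 3
    have "Re z - Re y = t * (Re x - Re y)" "Im z - Im y = t * (Im x - Im y)"
      using arg_cong[OF 3, of Re] arg_cong[OF 3, of Im] by simp_all
    then show ?thesis by simp
  qed simp_all
qed

lemma strict_triangle_if_not_collinear:
  fixes A B C :: complex
  assumes "\<not> collinear {A, B, C}"
  shows "dist A C < dist A B + dist B C"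
proof -
  have "\<not> between (A, C) B"
    using assms by (metis between_imp_collinear)
  then show ?thesis
    using dist_triangle[of A C B] by (simp add: between)
qed

text \<open>A diagonal cuts off two triangles. Non-collinearity makes the triangle inequality strict
  in one of them, and the weak inequality in the other completes the bound.\<close>

lemma quadrilateral_side_less:
  assumes "quadrilateral (A, B, C, D)"
  shows "dist D A < dist A B + dist B C + dist C D"
    and "dist A B < dist B C + dist C D + dist D A"
    and "dist B C < dist C D + dist D A + dist A B"
    and "dist C D < dist D A + dist A B + dist B C"
proof -
  have nc: "\<not> collinear {A, B, C}" "\<not> collinear {B, C, D}" "\<not> collinear {C, D, A}"
    "\<not> collinear {D, A, B}"
    using assms by auto
  note * = nc[THEN strict_triangle_if_not_collinear]
  show "dist D A < dist A B + dist B C + dist C D"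
    using *(1) dist_triangle[of A D C] by (simp add: dist_commute)
  show "dist A B < dist B C + dist C D + dist D A"
    using *(2) dist_triangle[of A B D] by (simp add: dist_commute)
  show "dist B C < dist C D + dist D A + dist A B"
    using *(3) dist_triangle[of B C A] by (simp add: dist_commute)
  show "dist C D < dist D A + dist A B + dist B C"
    using *(4) dist_triangle[of C D B] by (simp add: dist_commute)
qed

text \<open>The base runs from \<open>(0, 0)\<close> to \<open>(x, 0)\<close>; the apex
  \<open>(p, h)\<close> has distance \<open>a\<close> from the first endpoint and \<open>b\<close>
  from the second.\<close>

lemma triangle_apex_exists:
  fixes x a b :: real
  assumes "x > 0" "a > 0" "b > 0" "x < a + b" "a < x + b" "b < x + a"
  obtains p h where "h > 0" "p\<^sup>2 + h\<^sup>2 = a\<^sup>2" "(p - x)\<^sup>2 + h\<^sup>2 = b\<^sup>2"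
proof
  \<comment> \<open>Subtracting the two distance equations cancels \<open>h\<close> and leaves a
    linear equation for \<open>p\<close>.\<close>
  define p where "p = (x\<^sup>2 + a\<^sup>2 - b\<^sup>2) / (2 * x)"
  have px: "2 * x * p = x\<^sup>2 + a\<^sup>2 - b\<^sup>2"
    using assms by (simp add: p_def)
  \<comment> \<open>As in Heron's formula, the triangle inequalities make all factors positive, so
    \<open>-a < p < a\<close> and the height is real.\<close>
  have "2 * x * (a - p) = (b - (x - a)) * (b + (x - a))"
    "2 * x * (a + p) = (x + a - b) * (x + a + b)"
    using px by (simp_all add: algebra_simps power2_eq_square)
  then have "0 < 2 * x * (a - p)" "0 < 2 * x * (a + p)"
    using assms by simp_all
  then have "0 < a - p" "0 < a + p"
    using assms(1) by (simp_all add: zero_less_mult_iff)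
  then have "0 < (a - p) * (a + p)" by simp
  then have pos: "0 < a\<^sup>2 - p\<^sup>2"
    by (simp add: algebra_simps power2_eq_square)
  show "sqrt (a\<^sup>2 - p\<^sup>2) > 0" using pos by simp
  show "p\<^sup>2 + (sqrt (a\<^sup>2 - p\<^sup>2))\<^sup>2 = a\<^sup>2" using pos by simp
  show "(p - x)\<^sup>2 + (sqrt (a\<^sup>2 - p\<^sup>2))\<^sup>2 = b\<^sup>2"
    using pos px by (simp add: power2_diff algebra_simps)
qed

text \<open>One segment rises from the real axis and the other descends from it, so a common point
  lies on the axis and equals both \<open>A\<close> and \<open>C\<close>.\<close>

lemma segments_from_axis_disjoint:
  assumes "Im A = 0" "Im C = 0" "A \<noteq> C" "Im B > 0" "Im D < 0"
  shows "closed_segment A B \<inter> closed_segment C D = {}"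
proof (rule ccontr)
  assume "\<not> ?thesis"
  then obtain u v where u: "0 \<le> u" and v: "0 \<le> v"
    and eq: "(1 - u) *\<^sub>R A + u *\<^sub>R B = (1 - v) *\<^sub>R C + v *\<^sub>R D"
    unfolding closed_segment_def by auto
  have im: "u * Im B = v * Im D"
    using arg_cong[OF eq, of Im] assms by simp
  have "0 \<le> u * Im B" "v * Im D \<le> 0"
    using u v assms by (simp_all add: mult_nonneg_nonpos)
  with im have "u * Im B = 0" "v * Im D = 0" by linarith+
  then have "u = 0" "v = 0" using assms by simp_all
  with eq assms show False by simp
qed

text \<open>
  Two triangles are glued along a common diagonal of length \<open>x\<close>. A straight angle at an endpoint
  of the diagonal prescribes \<open>x\<^sup>2\<close> (Stewart's theorem).
\<close>

lemma straight_angle_diagonal: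
  fixes x a b c d p q h k :: real
  assumes "a > 0" "d > 0" "h > 0" "k > 0"
    and "p\<^sup>2 + h\<^sup>2 = a\<^sup>2" "(p - x)\<^sup>2 + h\<^sup>2 = b\<^sup>2"
    and "q\<^sup>2 + k\<^sup>2 = d\<^sup>2" "(q - x)\<^sup>2 + k\<^sup>2 = c\<^sup>2"
    and cross: "p * k = - (q * h)"
  shows "x\<^sup>2 = (a * (c\<^sup>2 - d\<^sup>2) + d * (b\<^sup>2 - a\<^sup>2)) / (a + d)"
proof -
  \<comment> \<open>The hypothesis \<open>cross\<close> says that the apexes are opposite:
    \<open>(q, -k) = -t (p, h)\<close>. Comparing lengths, \<open>t\<close> is also
    \<open>d / a\<close>.\<close>
  define t where "t = k / h"
  have t: "t > 0" "k = t * h" using assms by (simp_all add: t_def)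
  have "h * (q + t * p) = 0"
    using cross t(2) by (simp add: algebra_simps)
  then have q: "q = - (t * p)"
    using assms(3) by simp
  have "d\<^sup>2 = (t * a)\<^sup>2"
    using assms(5,7) t(2) q by (simp add: power_mult_distrib flip: assms(5) distrib_left)
  then have d: "d = t * a"
    using assms(1,2) t(1) by (simp add: power2_eq_iff_nonneg)
  have e: "2 * x * p = x\<^sup>2 + a\<^sup>2 - b\<^sup>2" "2 * x * q = x\<^sup>2 + d\<^sup>2 - c\<^sup>2"
    using assms(5-8) by (simp_all add: power2_diff algebra_simps)
  have "t * (x\<^sup>2 + a\<^sup>2 - b\<^sup>2) + (x\<^sup>2 + d\<^sup>2 - c\<^sup>2) = 0"
    unfolding e[symmetric] q by simp
  then have "a * (t * (x\<^sup>2 + a\<^sup>2 - b\<^sup>2) + (x\<^sup>2 + d\<^sup>2 - c\<^sup>2)) = 0"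
    by simp
  then have "x\<^sup>2 * (a + d) = a * (c\<^sup>2 - d\<^sup>2) + d * (b\<^sup>2 - a\<^sup>2)"
    unfolding d by (simp add: algebra_simps)
  then show ?thesis using assms(1,2) by (simp add: field_simps)
qed

text \<open>A diagonal \<open>x\<close> strictly between \<open>l\<close> and \<open>r\<close> fits
  both triangles, and at most two such values give a straight angle. With the apexes on opposite
  sides of the diagonal, opposite sides do not meet.\<close>

lemma quadrilateral_with_sides_exists:
  fixes a b c d :: real
  assumes pos: "a > 0" "b > 0" "c > 0" "d > 0"
    and less: "a < b + c + d" "b < c + d + a" "c < d + a + b" "d < a + b + c"
  obtains Q where "quadrilateral Q" "side_lengths Q = [a, b, c, d]"
proof -
  define l where "l = max \<bar>a - b\<bar> \<bar>c - d\<bar>"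
  define r where "r = min (a + b) (c + d)"
  \<comment> \<open>\<open>u\<close> and \<open>v\<close> are the values that collinearity at
    \<open>A\<close> and at \<open>C\<close> would force on \<open>x\<^sup>2\<close>.\<close>
  define u where "u = (a * (c\<^sup>2 - d\<^sup>2) + d * (b\<^sup>2 - a\<^sup>2)) / (a + d)"
  define v where "v = (b * (d\<^sup>2 - c\<^sup>2) + c * (a\<^sup>2 - b\<^sup>2)) / (b + c)"
  have "l < r" using pos less by (auto simp: l_def r_def)
  then have "infinite {l<..<r}" by simp
  then obtain x where "x \<in> {l<..<r}" "x \<notin> {sqrt u, sqrt v}"
    by (metis finite.emptyI finite.insertI finite_subset subsetI)
  then have x: "l < x" "x < r" "x \<noteq> sqrt u" "x \<noteq> sqrt v" by auto
  then have x0: "x > 0" by (auto simp: l_def)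
  have xu: "x\<^sup>2 \<noteq> u" "x\<^sup>2 \<noteq> v" using x x0 by auto
  obtain p h where ph: "h > 0" "p\<^sup>2 + h\<^sup>2 = a\<^sup>2" "(p - x)\<^sup>2 + h\<^sup>2 = b\<^sup>2"
    by (rule triangle_apex_exists[of x a b]) (use x x0 pos in \<open>auto simp: l_def r_def\<close>)
  obtain q k where qk: "k > 0" "q\<^sup>2 + k\<^sup>2 = d\<^sup>2" "(q - x)\<^sup>2 + k\<^sup>2 = c\<^sup>2"
    by (rule triangle_apex_exists[of x d c]) (use x x0 pos in \<open>auto simp: l_def r_def\<close>)
  define A B C D where "A = Complex 0 0" and "B = Complex p h"
    and "C = Complex x 0" and "D = Complex q (- k)"
  note defs = A_def B_def C_def D_def
  have "dist A B = a" "dist D A = d"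
    using ph qk pos by (simp_all add: defs dist_norm complex_diff complex_norm)
  moreover have "dist B C = b" "dist C D = c"
    using ph qk pos
    by (simp_all add: defs dist_norm complex_diff complex_norm power2_commute[of x q])
  ultimately have sides: "side_lengths (A, B, C, D) = [a, b, c, d]" by simp
  have "\<not> collinear {A, B, C}"
    using collinear_complex_cross[of A B C] ph x0 by (auto simp: defs algebra_simps)
  moreover have "\<not> collinear {C, D, A}"
    using collinear_complex_cross[of C D A] qk x0 by (auto simp: defs algebra_simps)
  moreover have "\<not> collinear {D, A, B}"
  proof
    assume "collinear {D, A, B}"
    then have "p * k = - (q * h)"
      using collinear_complex_cross[of D A B] by (simp add: defs algebra_simps)
    then have "x\<^sup>2 = u"
      unfolding u_def using straight_angle_diagonal[of a d h k p x b q c] pos ph qk by blast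
    with xu show False by simp
  qed
  moreover have "\<not> collinear {B, C, D}"
  proof
    assume "collinear {B, C, D}"
    then have "(x - p) * k = - ((x - q) * h)"
      using collinear_complex_cross[of B C D] by (simp add: defs algebra_simps)
    \<comment> \<open>Measuring abscissas backwards from \<open>C\<close> lets \<open>C\<close> play
      the role of \<open>A\<close>, with \<open>a\<close>, \<open>b\<close> and \<open>c\<close>,
      \<open>d\<close> exchanged.\<close>
    moreover have "(x - p)\<^sup>2 + h\<^sup>2 = b\<^sup>2" "(x - p - x)\<^sup>2 + h\<^sup>2 = a\<^sup>2"
      "(x - q)\<^sup>2 + k\<^sup>2 = c\<^sup>2" "(x - q - x)\<^sup>2 + k\<^sup>2 = d\<^sup>2"
      using ph qk by (simp_all add: power2_commute)
    ultimately have "x\<^sup>2 = v"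
      unfolding v_def using straight_angle_diagonal[of b c h k "x - p" x a "x - q" d] pos ph qk
      by blast
    with xu show False by simp
  qed
  moreover have "closed_segment A B \<inter> closed_segment C D = {}"
    using segments_from_axis_disjoint[of A C B D] ph qk x0 by (simp add: defs)
  moreover have "closed_segment B C \<inter> closed_segment D A = {}"
    using segments_from_axis_disjoint[of C A B D] ph qk x0
    by (simp add: defs closed_segment_commute)
  ultimately show thesis using that[of "(A, B, C, D)"] sides by simp
qed

section \<open>Reduction to integer tuples\<close>

definition quad_sides :: "nat \<Rightarrow> (nat \<times> nat \<times> nat \<times> nat) set" where
  "quad_sides n = {(a, b, c, d). 0 < a \<and> 0 < b \<and> 0 < c \<and> 0 < d \<and> a + b + c + d = n \<and>
     2 * a < n \<and> 2 * b < n \<and> 2 * c < n \<and> 2 * d < n}"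

lemma integer_quads_iff:
  "Q \<in> integer_quads n \<longleftrightarrow> quadrilateral Q \<and>
     (\<exists>a b c d. (a, b, c, d) \<in> quad_sides n \<and>
        side_lengths Q = [real a, real b, real c, real d])"
proof
  assume Q: "Q \<in> integer_quads n"
  obtain A B C D where ABCD: "Q = (A, B, C, D)" by (cases Q)
  have nat: "\<exists>k. s = real k" if "s \<in> \<int>" "0 < s" for s :: real
    using that by (metis Nats_cases Nats_altdef2 less_imp_le mem_Collect_eq)
  have quad: "quadrilateral (A, B, C, D)"
    and sides: "\<forall>s \<in> set (side_lengths (A, B, C, D)). s \<in> \<int> \<and> 0 < s"
    and per: "perimeter (A, B, C, D) = real n"
    using Q by (auto simp: ABCD integer_quads_def integer_quadrilateral_def)
  from sides obtain a b c d :: nat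
    where eqs: "dist A B = a" "dist B C = b" "dist C D = c" "dist D A = d"
    using nat by (metis side_lengths.simps list.set_intros)
  have "real (a + b + c + d) = real n"
    using per eqs by (simp add: perimeter_def)
  then have sum: "a + b + c + d = n" by linarith
  have pos: "0 < a" "0 < b" "0 < c" "0 < d" using sides eqs by auto
  have "real d < real a + real b + real c" "real a < real b + real c + real d"
    "real b < real c + real d + real a" "real c < real d + real a + real b"
    using quadrilateral_side_less[OF quad] unfolding eqs by auto
  then have "d < a + b + c" "a < b + c + d" "b < c + d + a" "c < d + a + b" by linarith+
  then have "(a, b, c, d) \<in> quad_sides n"
    using sum pos by (auto simp: quad_sides_def)
  then show "quadrilateral Q \<and> (\<exists>a b c d. (a, b, c, d) \<in> quad_sides n \<and>
        side_lengths Q = [real a, real b, real c, real d])"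
    using quad eqs by (auto simp: ABCD)
qed (auto simp: integer_quads_def integer_quadrilateral_def perimeter_def quad_sides_def)

lemma quad_sides_realised:
  assumes "(a, b, c, d) \<in> quad_sides n"
  obtains Q where "Q \<in> integer_quads n" "side_lengths Q = [real a, real b, real c, real d]"
proof -
  have "real a < real b + real c + real d" "real b < real c + real d + real a"
    "real c < real d + real a + real b" "real d < real a + real b + real c"
    "0 < real a" "0 < real b" "0 < real c" "0 < real d"
    using assms by (auto simp: quad_sides_def)
  then obtain Q where "quadrilateral Q" "side_lengths Q = [real a, real b, real c, real d]"
    using quadrilateral_with_sides_exists by metis
  then show thesis using that assms unfolding integer_quads_iff by blast
qed

section \<open>Side tuples up to rotation and reversal\<close>

text \<open>All eight images are listed, so that the laws of an equivalence relation become finite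
  case checks.\<close>

definition dihedral_eq :: "'a \<times> 'a \<times> 'a \<times> 'a \<Rightarrow> 'a \<times> 'a \<times> 'a \<times> 'a \<Rightarrow> bool" where
  "dihedral_eq = (\<lambda>(a, b, c, d) t. t \<in>
     {(a, b, c, d), (b, c, d, a), (c, d, a, b), (d, a, b, c),
      (d, c, b, a), (c, b, a, d), (b, a, d, c), (a, d, c, b)})"

lemma rotate_four_iff:
  "(\<exists>k. ys = rotate k [a, b, c, d]) \<longleftrightarrow>
     ys \<in> {[a, b, c, d], [b, c, d, a], [c, d, a, b], [d, a, b, c]}"
proof
  assume "\<exists>k. ys = rotate k [a, b, c, d]"
  then obtain k where "ys = rotate k [a, b, c, d]" by blast
  \<comment> \<open>Only the rotation amount modulo 4 matters.\<close>
  moreover define j where "j = k mod length [a, b, c, d]"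
  ultimately have "ys = rotate j [a, b, c, d]"
    by (metis rotate_conv_mod)
  moreover have "j < 4" by (simp add: j_def)
  then have "j = 0 \<or> j = Suc 0 \<or> j = Suc (Suc 0) \<or> j = Suc (Suc (Suc 0))" by linarith
  ultimately show "ys \<in> {[a, b, c, d], [b, c, d, a], [c, d, a, b], [d, a, b, c]}"
    by (elim disjE) simp_all
next
  have "rotate 0 [a, b, c, d] = [a, b, c, d]" "rotate 1 [a, b, c, d] = [b, c, d, a]"
    "rotate 2 [a, b, c, d] = [c, d, a, b]" "rotate 3 [a, b, c, d] = [d, a, b, c]"
    by (simp_all add: numeral_eq_Suc)
  moreover assume "ys \<in> {[a, b, c, d], [b, c, d, a], [c, d, a, b], [d, a, b, c]}"
  ultimately show "\<exists>k. ys = rotate k [a, b, c, d]" by (metis empty_iff insert_iff)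
qed

lemma equivalent_quads_iff:
  assumes "side_lengths P = [real a, real b, real c, real d]"
    and "side_lengths Q = [real a', real b', real c', real d']"
  shows "equivalent_quads P Q \<longleftrightarrow> dihedral_eq (a, b, c, d) (a', b', c', d')"
  unfolding equivalent_quads_def ex_disj_distrib assms rev.simps append.simps rotate_four_iff
  by (auto simp: dihedral_eq_def)

lemma dihedral_eq_refl: "dihedral_eq t t"
  by (cases t) (simp add: dihedral_eq_def)

lemma dihedral_eq_sym: "dihedral_eq s t \<Longrightarrow> dihedral_eq t s"
  by (cases s; cases t) (auto simp: dihedral_eq_def)

lemma dihedral_eq_trans: "dihedral_eq s t \<Longrightarrow> dihedral_eq t u \<Longrightarrow> dihedral_eq s u"
  by (cases s; cases t; cases u; simp add: dihedral_eq_def; elim disjE; simp)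

lemma equiv_quad_equiv: "equiv (integer_quads n) (quad_equiv n)"
proof (rule equivI)
  show "quad_equiv n \<subseteq> integer_quads n \<times> integer_quads n"
    by (auto simp: quad_equiv_def)
  show "refl_on (integer_quads n) (quad_equiv n)"
    by (rule refl_onI)
      (auto simp: quad_equiv_def integer_quads_iff equivalent_quads_iff dihedral_eq_refl)
  show "sym (quad_equiv n)"
    by (rule symI)
      (auto simp: quad_equiv_def integer_quads_iff equivalent_quads_iff intro: dihedral_eq_sym)
  show "trans (quad_equiv n)"
    by (rule transI)
      (auto simp: quad_equiv_def integer_quads_iff equivalent_quads_iff intro: dihedral_eq_trans)
qed

text \<open>
  The dihedral orbit of \<open>(a, b, c, d)\<close> amounts to the unordered pair of the unordered pairs
  \<open>{a, c}\<close> and \<open>{b, d}\<close> of opposite sides, so sorting yields a normal form. Comparing the two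
  pairs by their sums first makes the normal forms easy to count.
\<close>

definition reduced_sides :: "nat \<Rightarrow> (nat \<times> nat \<times> nat \<times> nat) set" where
  "reduced_sides n = {(a, b, c, d) \<in> quad_sides n.
     a \<le> c \<and> b \<le> d \<and> (a + c < b + d \<or> a + c = b + d \<and> a \<le> b)}"

text \<open>The inequalities fix the order within each opposite pair and between the pairs. If the
  sums tie and also \<open>a = b\<close>, then \<open>c = d\<close>, so exchanging the pairs changes
  nothing.\<close>

lemma reduced_sides_unique:
  assumes "s \<in> reduced_sides n" "t \<in> reduced_sides n" "dihedral_eq s t"
  shows "s = t"
  using assms by (cases s; cases t) (auto simp: reduced_sides_def dihedral_eq_def)

lemma reduced_sides_exists:
  assumes "s \<in> quad_sides n"
  obtains t where "t \<in> reduced_sides n" "dihedral_eq s t"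
proof -
  obtain a b c d where s: "s = (a, b, c, d)" by (cases s)
  \<comment> \<open>Sort both opposite pairs, then exchange the pairs if they are in the wrong
    order; each of these moves is a reflection.\<close>
  define t where "t = (let p = min a c; r = max a c; q = min b d; u = max b d in
    if p + r < q + u \<or> p + r = q + u \<and> p \<le> q then (p, q, r, u) else (q, p, u, r))"
  have "t \<in> reduced_sides n"
    using assms
    by (auto simp: t_def s Let_def min_def max_def reduced_sides_def quad_sides_def)
  moreover have "dihedral_eq s t"
    by (auto simp: t_def s Let_def min_def max_def dihedral_eq_def)
  ultimately show thesis using that by blast
qed

text \<open>Choose a quadrilateral \<open>q t\<close> realising each tuple \<open>t\<close>. Sending
  a normal form \<open>t\<close> to the class of \<open>q t\<close> is injective by uniqueness of
  normal forms and surjective by their existence.\<close>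

lemma num_integer_quads_eq_card_reduced:
  "num_integer_quads n = card (reduced_sides n)"
proof -
  define sides :: "nat \<times> nat \<times> nat \<times> nat \<Rightarrow> real list"
    where "sides = (\<lambda>(a, b, c, d). [real a, real b, real c, real d])"
  have "\<exists>Q. Q \<in> integer_quads n \<and> side_lengths Q = sides t" if "t \<in> quad_sides n" for t
    using that by (cases t) (metis (no_types, lifting) case_prod_conv quad_sides_realised sides_def)
  then obtain q where q: "\<And>t. t \<in> quad_sides n \<Longrightarrow> q t \<in> integer_quads n"
    "\<And>t. t \<in> quad_sides n \<Longrightarrow> side_lengths (q t) = sides t"
    by metis
  have red: "t \<in> quad_sides n" if "t \<in> reduced_sides n" for t
    using that by (auto simp: reduced_sides_def)
  have rel: "(P, q t) \<in> quad_equiv n \<longleftrightarrow> dihedral_eq s t"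
    if "P \<in> integer_quads n" "side_lengths P = sides s" "t \<in> quad_sides n" for P s t
    using that q(1)[OF that(3)] q(2)[OF that(3)]
    by (cases s; cases t) (simp add: quad_equiv_def sides_def equivalent_quads_iff)
  have "bij_betw (\<lambda>t. quad_equiv n `` {q t}) (reduced_sides n) (integer_quads n // quad_equiv n)"
    unfolding bij_betw_def
  proof
    show "inj_on (\<lambda>t. quad_equiv n `` {q t}) (reduced_sides n)"
    proof (rule inj_onI)
      fix s t assume st: "s \<in> reduced_sides n" "t \<in> reduced_sides n"
        and eq: "quad_equiv n `` {q s} = quad_equiv n `` {q t}"
      have "(q s, q t) \<in> quad_equiv n"
        using eq q(1)[OF red[OF st(1)]] q(1)[OF red[OF st(2)]]
          eq_equiv_class_iff[OF equiv_quad_equiv] by blast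
      then have "dihedral_eq s t"
        using rel q red st by blast
      then show "s = t" using st reduced_sides_unique by blast
    qed
    show "(\<lambda>t. quad_equiv n `` {q t}) ` reduced_sides n = integer_quads n // quad_equiv n"
    proof
      show "(\<lambda>t. quad_equiv n `` {q t}) ` reduced_sides n \<subseteq> integer_quads n // quad_equiv n"
        using q(1) red by (auto intro: quotientI)
      show "integer_quads n // quad_equiv n \<subseteq> (\<lambda>t. quad_equiv n `` {q t}) ` reduced_sides n"
      proof
        fix X assume "X \<in> integer_quads n // quad_equiv n"
        then obtain P where P: "P \<in> integer_quads n" "X = quad_equiv n `` {P}"
          by (auto elim: quotientE)
        then obtain s where s: "s \<in> quad_sides n" "side_lengths P = sides s"
          by (auto simp: integer_quads_iff sides_def)
        obtain t where t: "t \<in> reduced_sides n" "dihedral_eq s t"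
          using reduced_sides_exists[OF s(1)] .
        then have "(P, q t) \<in> quad_equiv n" using rel P s red by blast
        then have "X = quad_equiv n `` {q t}"
          using P equiv_class_eq[OF equiv_quad_equiv] by blast
        then show "X \<in> (\<lambda>t. quad_equiv n `` {q t}) ` reduced_sides n"
          using t by blast
      qed
    qed
  qed
  then show ?thesis
    unfolding num_integer_quads_def by (metis bij_betw_same_card)
qed

section \<open>Counting\<close>

lemma card_reduced_unequal:
  "card {(a, b, c, d) \<in> reduced_sides n. a + c < b + d} =
     (\<Sum>s | 2 * s < n. (s div 2) * ((n - s) div 2 - (n div 2 - s)))"
proof -
  \<comment> \<open>Here \<open>s = a + c\<close>. The lower bound on \<open>b\<close> expresses
    \<open>2 * d < n\<close> for \<open>d = n - s - b\<close>; the upper bounds express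
    \<open>a \<le> c\<close> and \<open>b \<le> d\<close>.\<close>
  define T where "T = Sigma {s. 2 * s < n}
    (\<lambda>s. {0<..s div 2} \<times> {n div 2 - s<..(n - s) div 2})"
  define g where "g = (\<lambda>(s, a, b). (a, b, s - a, n - s - b))"
  have "g ` T = {(a, b, c, d) \<in> reduced_sides n. a + c < b + d}"
  proof
    show "g ` T \<subseteq> {(a, b, c, d) \<in> reduced_sides n. a + c < b + d}"
      by (auto simp: T_def g_def reduced_sides_def quad_sides_def)
    show "{(a, b, c, d) \<in> reduced_sides n. a + c < b + d} \<subseteq> g ` T"
    proof clarify
      fix a b c d assume "(a, b, c, d) \<in> reduced_sides n" "a + c < b + d"
      then have "(a + c, a, b) \<in> T" "g (a + c, a, b) = (a, b, c, d)"
        by (auto simp: T_def g_def reduced_sides_def quad_sides_def)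
      then show "(a, b, c, d) \<in> g ` T" by (metis imageI)
    qed
  qed
  moreover have "inj_on g T"
    by (rule inj_on_inverseI[of _ "\<lambda>(a, b, c, d). (a + c, a, b)"]) (auto simp: T_def g_def)
  ultimately have "card {(a, b, c, d) \<in> reduced_sides n. a + c < b + d} = card T"
    by (metis card_image)
  moreover have "finite {s. 2 * s < n}"
    by (rule finite_subset[of _ "{..n}"]) auto
  ultimately show ?thesis by (simp add: T_def)
qed

text \<open>With both sums equal to \<open>m\<close>, a normal form is given by
  \<open>a \<le> b \<le> m div 2\<close>, which leaves \<open>b\<close> choices of \<open>a\<close>
  for each \<open>b\<close>.\<close>

lemma card_reduced_equal:
  "card {(a, b, c, d) \<in> reduced_sides (2 * m). a + c = b + d} = (\<Sum>b\<in>{0<..m div 2}. b)"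
proof -
  define T where "T = Sigma {0<..m div 2} (\<lambda>b. {0<..b})"
  define g where "g = (\<lambda>(b, a). (a, b, m - a, m - b))"
  have "g ` T = {(a, b, c, d) \<in> reduced_sides (2 * m). a + c = b + d}"
  proof
    show "g ` T \<subseteq> {(a, b, c, d) \<in> reduced_sides (2 * m). a + c = b + d}"
      by (auto simp: T_def g_def reduced_sides_def quad_sides_def)
    show "{(a, b, c, d) \<in> reduced_sides (2 * m). a + c = b + d} \<subseteq> g ` T"
    proof clarify
      fix a b c d assume "(a, b, c, d) \<in> reduced_sides (2 * m)" "a + c = b + d"
      then have "(b, a) \<in> T" "g (b, a) = (a, b, c, d)"
        by (auto simp: T_def g_def reduced_sides_def quad_sides_def)
      then show "(a, b, c, d) \<in> g ` T" by (metis imageI)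
    qed
  qed
  moreover have "inj_on g T"
    by (auto simp: inj_on_def T_def g_def)
  ultimately have "card {(a, b, c, d) \<in> reduced_sides (2 * m). a + c = b + d} = card T"
    by (metis card_image)
  then show ?thesis by (simp add: T_def)
qed

lemma finite_reduced_sides: "finite (reduced_sides n)"
proof (rule finite_subset)
  show "reduced_sides n \<subseteq> {..n} \<times> {..n} \<times> {..n} \<times> {..n}"
    by (auto simp: reduced_sides_def quad_sides_def)
qed simp

lemma card_reduced_sides_even:
  "card (reduced_sides (2 * m)) = (\<Sum>s<m. (s div 2)\<^sup>2) + (\<Sum>b\<in>{0<..m div 2}. b)"
proof -
  have "reduced_sides (2 * m) = {(a, b, c, d) \<in> reduced_sides (2 * m). a + c < b + d} \<union>
      {(a, b, c, d) \<in> reduced_sides (2 * m). a + c = b + d}" (is "_ = ?X \<union> ?Y")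
    by (auto simp: reduced_sides_def)
  moreover have "card (?X \<union> ?Y) = card ?X + card ?Y"
    by (rule card_Un_disjoint) (auto intro: finite_subset[OF _ finite_reduced_sides])
  moreover have "card ?X = (\<Sum>s<m. (s div 2)\<^sup>2)"
    unfolding card_reduced_unequal
  proof (rule sum.cong)
    fix s assume "s \<in> {..<m}"
    then have "(2 * m - s) div 2 - (2 * m div 2 - s) = s div 2" by auto
    then show "s div 2 * ((2 * m - s) div 2 - (2 * m div 2 - s)) = (s div 2)\<^sup>2"
      by (simp only: power2_eq_square)
  qed auto
  ultimately show ?thesis using card_reduced_equal[of m] by simp
qed

text \<open>The two opposite pairs have sums of different parity, so ties cannot occur. The value
  \<open>s = m\<close> is admissible here, hence the bound \<open>Suc m\<close>.\<close>

lemma card_reduced_sides_odd: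
  "card (reduced_sides (2 * m + 1)) = (\<Sum>s<Suc m. (s div 2) * ((s + 1) div 2))"
proof -
  have "a + c \<noteq> b + d" if "(a, b, c, d) \<in> reduced_sides (2 * m + 1)" for a b c d
  proof -
    have "(a + c) + (b + d) = 2 * m + 1"
      using that by (auto simp: reduced_sides_def quad_sides_def)
    then show ?thesis by presburger
  qed
  then have "reduced_sides (2 * m + 1) =
      {(a, b, c, d) \<in> reduced_sides (2 * m + 1). a + c < b + d}"
    by (fastforce simp: reduced_sides_def)
  then have "card (reduced_sides (2 * m + 1)) =
      card {(a, b, c, d) \<in> reduced_sides (2 * m + 1). a + c < b + d}"
    by (rule arg_cong)
  also have "\<dots> = (\<Sum>s | 2 * s < 2 * m + 1.
      (s div 2) * ((2 * m + 1 - s) div 2 - ((2 * m + 1) div 2 - s)))"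
    by (rule card_reduced_unequal)
  also have "\<dots> = (\<Sum>s<Suc m. (s div 2) * ((s + 1) div 2))"
  proof (rule sum.cong)
    fix s assume "s \<in> {..<Suc m}"
    then have "(2 * m + 1 - s) div 2 - ((2 * m + 1) div 2 - s) = (s + 1) div 2" by auto
    then show "s div 2 * ((2 * m + 1 - s) div 2 - ((2 * m + 1) div 2 - s)) =
        (s div 2) * ((s + 1) div 2)"
      by (simp only:)
  qed auto
  finally show ?thesis .
qed

section \<open>Closed forms and rounding\<close>

lemma sum_triangular: "2 * real (\<Sum>b\<in>{0<..k}. b) = real k * (real k + 1)"
proof (induction k)
  case (Suc k)
  have "{0<..Suc k} = insert (Suc k) {0<..k}" by auto
  then show ?case using Suc by (simp add: algebra_simps)
qed simp

text \<open>With an even number of summands, each induction step adds the terms for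
  \<open>2 * k\<close> and \<open>2 * k + 1\<close>, where the floors are explicit.\<close>

lemma sum_half_squares:
  "6 * real (\<Sum>s<2 * k. (s div 2)\<^sup>2) = 4 * real k ^ 3 - 6 * real k ^ 2 + 2 * real k"
  by (induction k) (simp_all add: algebra_simps power2_eq_square power3_eq_cube)

lemma sum_quarter_squares:
  "6 * real (\<Sum>s<2 * k. (s div 2) * ((s + 1) div 2)) = 4 * real k ^ 3 - 3 * real k ^ 2 - real k"
  by (induction k) (simp_all add: algebra_simps power2_eq_square power3_eq_cube)

theorem theorem1p9:
  fixes n :: nat
  assumes "n > 0"
  shows "int (num_integer_quads n) =
    (if even n then round ((real n ^ 3 - 3 * real n ^ 2 + 20 * real n) / 96)
     else round ((real n ^ 3 - 7 * real n) / 96))"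
proof -
  define N where "N = real (num_integer_quads n)"
  define k where "k = n div 4"
  \<comment> \<open>An error strictly below one half determines the nearest integer without
    ties.\<close>
  have round: "int (num_integer_quads n) = round x" if "\<bar>N - x\<bar> < 1/2" for x
    using round_unique'[of x "int (num_integer_quads n)"] that
    by (simp add: N_def abs_minus_commute)
  have "n mod 4 \<in> {0, 1, 2, 3}" by auto
  \<comment> \<open>The residues modulo 4 are written as \<open>2 * m\<close> or
    \<open>2 * m + 1\<close> with \<open>m\<close> either \<open>2 * k\<close> or
    \<open>2 * k + 1\<close>, to match the two counting lemmas.\<close>
  then consider "n = 2 * (2 * k)" | "n = 2 * (2 * k) + 1" | "n = 2 * (2 * k + 1)"
    | "n = 2 * (2 * k + 1) + 1"
    unfolding k_def by fastforce
  then show ?thesis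
  proof cases
    case 1
    then have "even n" by simp
    have "12 * N = 8 * real k ^ 3 - 6 * real k ^ 2 + 10 * real k"
      using sum_half_squares[of k] sum_triangular[of k]
      unfolding N_def num_integer_quads_eq_card_reduced 1 card_reduced_sides_even
      by (simp add: algebra_simps power2_eq_square)
    then have "N = (real n ^ 3 - 3 * real n ^ 2 + 20 * real n) / 96"
      by (simp add: 1 field_simps power2_eq_square power3_eq_cube)
    then have "\<bar>N - (real n ^ 3 - 3 * real n ^ 2 + 20 * real n) / 96\<bar> < 1/2"
      by linarith
    from round[OF this] show ?thesis using \<open>even n\<close> by simp
  next
    case 2
    then have "odd n" by simp
    \<comment> \<open>The range \<open>s < 2 * k + 1\<close> has one summand beyond the closed form,
      \<open>k\<^sup>2\<close> at \<open>s = 2 * k\<close>.\<close>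
    have "6 * N = 4 * real k ^ 3 + 3 * real k ^ 2 - real k"
      using sum_quarter_squares[of k]
      unfolding N_def num_integer_quads_eq_card_reduced 2 card_reduced_sides_odd
      by (simp add: algebra_simps power2_eq_square)
    then have "N = (real n ^ 3 - 7 * real n) / 96 + 1 / 16"
      by (simp add: 2 field_simps power2_eq_square power3_eq_cube)
    then have "\<bar>N - (real n ^ 3 - 7 * real n) / 96\<bar> < 1/2"
      by linarith
    from round[OF this] show ?thesis using \<open>odd n\<close> by simp
  next
    case 3
    then have "even n" by simp
    have "12 * N = 8 * real k ^ 3 + 6 * real k ^ 2 + 10 * real k"
      using sum_half_squares[of k] sum_triangular[of k]
      unfolding N_def num_integer_quads_eq_card_reduced 3 card_reduced_sides_even
      by (simp add: algebra_simps power2_eq_square)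
    then have "N = (real n ^ 3 - 3 * real n ^ 2 + 20 * real n) / 96 - 3 / 8"
      by (simp add: 3 field_simps power2_eq_square power3_eq_cube)
    then have "\<bar>N - (real n ^ 3 - 3 * real n ^ 2 + 20 * real n) / 96\<bar> < 1/2"
      by linarith
    from round[OF this] show ?thesis using \<open>even n\<close> by simp
  next
    case 4
    then have "odd n" by simp
    \<comment> \<open>Two summands exceed the closed form: \<open>k\<^sup>2\<close> at
      \<open>s = 2 * k\<close> and \<open>k * (k + 1)\<close> at
      \<open>s = 2 * k + 1\<close>.\<close>
    have "6 * N = 4 * real k ^ 3 + 9 * real k ^ 2 + 5 * real k"
      using sum_quarter_squares[of k]
      unfolding N_def num_integer_quads_eq_card_reduced 4 card_reduced_sides_odd
      by (simp add: algebra_simps power2_eq_square)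
    then have "N = (real n ^ 3 - 7 * real n) / 96 - 1 / 16"
      by (simp add: 4 field_simps power2_eq_square power3_eq_cube)
    then have "\<bar>N - (real n ^ 3 - 7 * real n) / 96\<bar> < 1/2"
      by linarith
    from round[OF this] show ?thesis using \<open>odd n\<close> by simp
  qed
qed

end
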